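(* Let $X$ be a compact Hausdorff space, let $\ast$ be a continuous t-norm, and let $\mu\in\mathcal T^\ast(X)$. Then $\mu\in A^\ast(X)$ if and only if there exists a unique possibility capacity $\nu\in\Pi X$ such that $\mu(f)=\int_X^{\vee\ast} f\,d\nu$ for each $f\in C(X,[0,1])$.
   Context: A t-norm is a binary operation $\ast$ on $[0,1]$ that is associative, commutative, monotone (nondecreasing in each argument), and satisfies $s\ast 1=s$ for all $s\in[0,1]$. Continuous means continuous as a map $[0,1]^2\to[0,1]$. For a compact Hausdorff space $X$, $C(X,[0,1])$ is the set of continuous functions $X\to[0,1]$, $c_X$ is the constant function with value $c$, and $\vee$ and $\ast$ are applied pointwise to functions; on numbers, $\vee$ is maximum. Functions $\varphi,\psi\in C(X,[0,1])$ are comonotone if $(\varphi(x_1)-\varphi(x_2))(\psi(x_1)-\psi(x_2))\ge 0$ for all $x_1,x_2\in X$. Let $\mathcal F(X)$ be the family of closed subsets of $X$. A capacity (always upper-semicontinuous) on $X$ is a function $\nu:\mathcal F(X)\to[0,1]$ such that for all closed $F,G\subset X$: (1) $\nu(X)=1$, $\nu(\emptyset)=0$; (2) $F\subset G$ implies $\nu(F)\le\nu(G)$; (3) if $\nu(F)<a$ for $a\in[0,1]$, then there is an open set $O\supset F$ such that $\nu(B)<a$ for each compact $B\subset O$. A capacity $\nu$ is a possibility capacity if for each family $\{A_t\}_{t\in T}$ of closed subsets of $X$ whose union is closed, $\nu(\bigcup_{t\in T}A_t)=\sup_{t\in T}\nu(A_t)$. $\Pi X$ is the set of all possibility capacities on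 $X$. For $f\in C(X,[0,1])$ and $t\in[0,1]$ put $f_t=f^{-1}([t,1])$. The t-normed integral of $f$ with respect to a capacity $\nu$ is $\int_X^{\vee\ast} f\,d\nu=\max\{\nu(f_t)\ast t\mid t\in[0,1]\}$. $\mathcal T^\ast(X)$ is the set of functionals $\mu:C(X,[0,1])\to[0,1]$ such that: (1) $\mu(1_X)=1$; (2) $\mu(\psi\vee\varphi)=\mu(\psi)\vee\mu(\varphi)$ for all comonotone $\varphi,\psi\in C(X,[0,1])$; (3) $\mu(c_X\ast\varphi)=c\ast\mu(\varphi)$ for all $c\in[0,1]$ and $\varphi\in C(X,[0,1])$. $A^\ast(X)$ is the set of $\ast$-measures, i.e. those $\mu\in\mathcal T^\ast(X)$ such that $\mu(\psi\vee\varphi)=\mu(\psi)\vee\mu(\varphi)$ for all $\varphi,\psi\in C(X,[0,1])$ (not only comonotone ones). *)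

theory Defs
  imports "HOL-Analysis.Analysis"
begin

definition tnorm :: "(real \<Rightarrow> real \<Rightarrow> real) \<Rightarrow> bool" where
  "tnorm T \<longleftrightarrow>
     (\<forall>s\<in>{0..1}. \<forall>t\<in>{0..1}. T s t \<in> {0..1}) \<and>
     (\<forall>r\<in>{0..1}. \<forall>s\<in>{0..1}. \<forall>t\<in>{0..1}. T (T r s) t = T r (T s t)) \<and>
     (\<forall>s\<in>{0..1}. \<forall>t\<in>{0..1}. T s t = T t s) \<and>
     (\<forall>s\<in>{0..1}. \<forall>s'\<in>{0..1}. \<forall>t\<in>{0..1}. \<forall>t'\<in>{0..1}.
        s \<le> s' \<longrightarrow> t \<le> t' \<longrightarrow> T s t \<le> T s' t') \<and>
     (\<forall>s\<in>{0..1}. T s 1 = s)"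

definition continuous_tnorm :: "(real \<Rightarrow> real \<Rightarrow> real) \<Rightarrow> bool" where
  "continuous_tnorm T \<longleftrightarrow>
     tnorm T \<and> continuous_on ({0..1} \<times> {0..1}) (\<lambda>(s, t). T s t)"

definition C01 :: "('a::topological_space \<Rightarrow> real) set" where
  "C01 = {f. continuous_on UNIV f \<and> (\<forall>x. f x \<in> {0..1})}"

definition comonotone :: "('a \<Rightarrow> real) \<Rightarrow> ('a \<Rightarrow> real) \<Rightarrow> bool" where
  "comonotone \<phi> \<psi> \<longleftrightarrow> (\<forall>x1 x2. (\<phi> x1 - \<phi> x2) * (\<psi> x1 - \<psi> x2) \<ge> 0)"

text \<open>Set functions and functionals are extensional (\<open>undefined\<close> off their domain), so that
  equality of two of them means equality on closed sets, respectively on \<open>C01\<close>.\<close>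

definition capacities :: "('a::topological_space set \<Rightarrow> real) set" where
  "capacities = {\<nu> \<in> {F. closed F} \<rightarrow>\<^sub>E {0..1}.
     \<nu> UNIV = 1 \<and> \<nu> {} = 0 \<and>
     (\<forall>F G. closed F \<and> closed G \<and> F \<subseteq> G \<longrightarrow> \<nu> F \<le> \<nu> G) \<and>
     (\<forall>F a. closed F \<and> a \<in> {0..1} \<and> \<nu> F < a \<longrightarrow>
        (\<exists>U. open U \<and> F \<subseteq> U \<and> (\<forall>B. compact B \<and> B \<subseteq> U \<longrightarrow> \<nu> B < a)))}"

text \<open>The supremum of the empty family, taken in \<open>[0,1]\<close>, is \<open>0\<close>; that instance is
  \<open>\<nu> {} = 0\<close>, and is left out below because \<open>Sup {}\<close> is unspecified on the reals.\<close>

definition possibility_capacities :: "('a::topological_space set \<Rightarrow> real) set" where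
  "possibility_capacities = {\<nu> \<in> capacities.
     \<forall>\<A>. \<A> \<noteq> {} \<and> (\<forall>A\<in>\<A>. closed A) \<and> closed (\<Union>\<A>) \<longrightarrow> \<nu> (\<Union>\<A>) = (SUP A\<in>\<A>. \<nu> A)}"

text \<open>\<open>GREATEST\<close> is the maximum of a possibly infinite set; it is attained for a continuous
  t-norm and a capacity on a compact Hausdorff space, by upper semicontinuity.\<close>

definition tnormed_integral ::
    "(real \<Rightarrow> real \<Rightarrow> real) \<Rightarrow> ('a set \<Rightarrow> real) \<Rightarrow> ('a \<Rightarrow> real) \<Rightarrow> real" where
  "tnormed_integral T \<nu> f = (GREATEST r. r \<in> {T (\<nu> (f -` {t..1})) t | t. t \<in> {0..1}})"

definition T_functionals ::
    "(real \<Rightarrow> real \<Rightarrow> real) \<Rightarrow> (('a::topological_space \<Rightarrow> real) \<Rightarrow> real) set" where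
  "T_functionals T = {\<mu> \<in> C01 \<rightarrow>\<^sub>E {0..1}.
     \<mu> (\<lambda>x. 1) = 1 \<and>
     (\<forall>\<phi>\<in>C01. \<forall>\<psi>\<in>C01. comonotone \<phi> \<psi> \<longrightarrow> \<mu> (\<lambda>x. max (\<psi> x) (\<phi> x)) = max (\<mu> \<psi>) (\<mu> \<phi>)) \<and>
     (\<forall>c\<in>{0..1}. \<forall>\<phi>\<in>C01. \<mu> (\<lambda>x. T c (\<phi> x)) = T c (\<mu> \<phi>))}"

definition star_measures ::
    "(real \<Rightarrow> real \<Rightarrow> real) \<Rightarrow> (('a::topological_space \<Rightarrow> real) \<Rightarrow> real) set" where
  "star_measures T = {\<mu> \<in> T_functionals T.
     \<forall>\<phi>\<in>C01. \<forall>\<psi>\<in>C01. \<mu> (\<lambda>x. max (\<psi> x) (\<phi> x)) = max (\<mu> \<psi>) (\<mu> \<phi>)}"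

end

theory Submission
  imports Defs
begin

text \<open>
  Uniqueness determines what the capacity has to be. If \<open>\<nu>\<close> represents \<open>\<mu>\<close>, then upper
  semicontinuity of \<open>\<nu>\<close> and Urysohn functions force \<open>\<nu> F\<close> to be the infimum of \<open>\<mu> f\<close> over the
  continuous \<open>f\<close> that are \<open>1\<close> on \<open>F\<close> (\<open>capacity_eq_outer_capacity\<close>). So for a star-measure \<open>\<mu>\<close>
  this infimum, the outer capacity of \<open>\<mu>\<close>, has to be shown to be a possibility capacity that
  represents \<open>\<mu>\<close>.

  The tool is a Markov inequality. A ramp of \<open>f\<close>, equal to \<open>0\<close> where \<open>f \<le> c\<close> and to \<open>1\<close> where
  \<open>f \<ge> d\<close>, satisfies \<open>T c (ramp c d f) \<le> f\<close>, so homogeneity and monotonicity of \<open>\<mu>\<close> give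
  \<open>T c (\<mu> (ramp c d f)) \<le> \<mu> f\<close>. With \<open>c\<close> close to \<open>1\<close>, where \<open>T c\<close> is uniformly close to the
  identity, a function that is \<open>1\<close> on \<open>F\<close> can be replaced by one that is \<open>1\<close> on a neighbourhood
  of \<open>F\<close>, at an arbitrarily small cost in \<open>\<mu>\<close> (\<open>thicken\<close>). This gives upper semicontinuity. It
  also gives the possibility property: if a closed set is a union of closed sets, the
  neighbourhoods cover it, finitely many suffice, and \<open>\<mu>\<close> of the maximum of finitely many functions
  is the maximum of the values. With \<open>c\<close> just below a level \<open>t\<close> of \<open>f\<close>, the same inequality shows
  that every term \<open>T (\<nu> (level f t)) t\<close> is at most \<open>\<mu> f\<close> (\<open>level_term_le\<close>). The reverse estimate
  (\<open>le_of_level_terms\<close>) dominates \<open>f\<close> by a maximum of finitely many functions \<open>T t g\<close> with \<open>g = 1\<close>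
  on a level set of \<open>f\<close>.

  Conversely, the level sets of \<open>max f g\<close> are unions of those of \<open>f\<close> and \<open>g\<close>, and the integral is
  an attained maximum, so the integral with respect to a possibility capacity preserves all binary
  maxima (\<open>integral_max\<close>).
\<close>

section \<open>Continuous functions into the unit interval\<close>

abbreviation level :: "('a \<Rightarrow> real) \<Rightarrow> real \<Rightarrow> 'a set" where
  "level f t \<equiv> f -` {t..1}"

definition ramp :: "real \<Rightarrow> real \<Rightarrow> ('a \<Rightarrow> real) \<Rightarrow> 'a \<Rightarrow> real" where
  "ramp c d f = (\<lambda>x. max 0 (min 1 ((f x - c) / (d - c))))"

lemma C01_range: "f \<in> C01 \<Longrightarrow> 0 \<le> f x \<and> f x \<le> 1"
  by (auto simp: C01_def)

lemma C01_continuous: "f \<in> C01 \<Longrightarrow> continuous_on UNIV f"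
  by (auto simp: C01_def)

lemma C01_const: "c \<in> {0..1} \<Longrightarrow> (\<lambda>x. c) \<in> C01"
  by (auto simp: C01_def)

lemma C01_max: "f \<in> C01 \<Longrightarrow> g \<in> C01 \<Longrightarrow> (\<lambda>x. max (f x) (g x)) \<in> C01"
  by (auto simp: C01_def le_max_iff_disj intro!: continuous_intros)

lemma C01_ramp: "f \<in> C01 \<Longrightarrow> c < d \<Longrightarrow> ramp c d f \<in> C01"
  by (auto simp: C01_def ramp_def intro!: continuous_intros)

lemma ramp_eq_1: "c < d \<Longrightarrow> d \<le> f x \<Longrightarrow> ramp c d f x = 1"
  by (simp add: ramp_def)

lemma ramp_eq_0: "c < d \<Longrightarrow> f x \<le> c \<Longrightarrow> ramp c d f x = 0"
  by (simp add: ramp_def divide_nonpos_pos)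

lemma level_iff: "f \<in> C01 \<Longrightarrow> x \<in> level f t \<longleftrightarrow> t \<le> f x"
  by (auto simp: C01_def)

lemma closed_level: "f \<in> C01 \<Longrightarrow> closed (level f t)"
  by (intro closed_vimage C01_continuous closed_real_atLeastAtMost)

lemma level_max:
  "f \<in> C01 \<Longrightarrow> g \<in> C01 \<Longrightarrow> level (\<lambda>x. max (f x) (g x)) t = level f t \<union> level g t"
  by (auto simp: C01_def le_max_iff_disj)

lemma closed_imp_compact:
  assumes "compact (UNIV :: 'a::topological_space set)" "closed (F :: 'a set)"
  shows "compact F"
  using compact_Int_closed[OF assms] by simp

lemma Urysohn_C01:
  fixes F U :: "'a::t2_space set"
  assumes "compact (UNIV :: 'a set)" "closed F" "open U" "F \<subseteq> U"
  obtains f where "f \<in> C01" "\<And>x. x \<in> F \<Longrightarrow> f x = 1" "\<And>x. x \<notin> U \<Longrightarrow> f x = 0"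
proof -
  have "Hausdorff_space (euclidean :: 'a topology)"
    using hausdorff by (fastforce simp: Hausdorff_space_def disjnt_def)
  then have "normal_space (euclidean :: 'a topology)"
    using assms(1)
    by (intro compact_Hausdorff_or_regular_imp_normal_space)
      (auto simp: compact_space_def)
  then obtain f where f: "continuous_map euclidean (top_of_set {0..1::real}) f"
      "f ` (- U) \<subseteq> {0}" "f ` F \<subseteq> {1}"
    by (rule Urysohn_lemma[of _ "- U" F 0 1]) (use assms in \<open>auto simp: disjnt_def\<close>)
  then have "f \<in> C01"
    by (auto simp: C01_def continuous_map_in_subtopology image_subset_iff)
  with f that show thesis by blast
qed

section \<open>Continuous t-norms\<close>

locale continuous_t_norm =
  fixes T :: "real \<Rightarrow> real \<Rightarrow> real"
  assumes continuous_tnorm: "continuous_tnorm T"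
begin

lemma T_range: "s \<in> {0..1} \<Longrightarrow> t \<in> {0..1} \<Longrightarrow> T s t \<in> {0..1}"
  using continuous_tnorm unfolding continuous_tnorm_def tnorm_def by blast

lemma T_commute: "s \<in> {0..1} \<Longrightarrow> t \<in> {0..1} \<Longrightarrow> T s t = T t s"
  using continuous_tnorm unfolding continuous_tnorm_def tnorm_def by blast

lemma T_mono:
  "s \<in> {0..1} \<Longrightarrow> s' \<in> {0..1} \<Longrightarrow> t \<in> {0..1} \<Longrightarrow> t' \<in> {0..1} \<Longrightarrow> s \<le> s' \<Longrightarrow> t \<le> t' \<Longrightarrow>
    T s t \<le> T s' t'"
  using continuous_tnorm unfolding continuous_tnorm_def tnorm_def by blast

lemma T_1: "s \<in> {0..1} \<Longrightarrow> T s 1 = s"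
  using continuous_tnorm unfolding continuous_tnorm_def tnorm_def by blast

lemma T_1_left: "s \<in> {0..1} \<Longrightarrow> T 1 s = s"
  using T_1[of s] T_commute[of 1 s] by simp

lemma T_le_left: "s \<in> {0..1} \<Longrightarrow> t \<in> {0..1} \<Longrightarrow> T s t \<le> s"
  using T_mono[of s s t 1] T_1[of s] by auto

lemma T_0: "s \<in> {0..1} \<Longrightarrow> T s 0 = 0"
  using T_le_left[of 0 s] T_commute[of 0 s] T_range[of s 0] by auto

lemma T_max_left:
  assumes "a \<in> {0..1}" "b \<in> {0..1}" "t \<in> {0..1}"
  shows "T (max a b) t = max (T a t) (T b t)"
  using T_mono[of a b t t] T_mono[of b a t t] assms by (auto simp: max_def)

lemma T_continuous: "continuous_on ({0..1} \<times> {0..1}) (\<lambda>p. T (fst p) (snd p))"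
  using continuous_tnorm by (simp add: continuous_tnorm_def case_prod_unfold)

lemma T_uniformly_continuous:
  assumes "0 < \<epsilon>"
  obtains \<delta> where "0 < \<delta>" and
    "\<And>s s' t t'. s \<in> {0..1} \<Longrightarrow> s' \<in> {0..1} \<Longrightarrow> t \<in> {0..1} \<Longrightarrow> t' \<in> {0..1} \<Longrightarrow>
      \<bar>s - s'\<bar> < \<delta> \<Longrightarrow> \<bar>t - t'\<bar> < \<delta> \<Longrightarrow> \<bar>T s t - T s' t'\<bar> < \<epsilon>"
proof -
  have "uniformly_continuous_on ({0..1} \<times> {0..1}) (\<lambda>p. T (fst p) (snd p))"
    by (intro compact_uniformly_continuous T_continuous compact_Times compact_Icc)
  then have "\<exists>\<delta>>0. \<forall>p\<in>{0..1} \<times> {0..1}. \<forall>q\<in>{0..1} \<times> {0..1}.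
      dist q p < \<delta> \<longrightarrow> dist (T (fst q) (snd q)) (T (fst p) (snd p)) < \<epsilon>"
    using assms unfolding uniformly_continuous_on_def by (elim allE[of _ \<epsilon>]) simp
  then obtain \<delta> where \<delta>: "0 < \<delta>" "\<forall>p\<in>{0..1} \<times> {0..1}. \<forall>q\<in>{0..1} \<times> {0..1}.
      dist q p < \<delta> \<longrightarrow> dist (T (fst q) (snd q)) (T (fst p) (snd p)) < \<epsilon>"
    by (elim exE conjE)
  show thesis
  proof
    show "0 < \<delta> / 2" using \<delta> by simp
    fix s s' t t' :: real
    assume *: "s \<in> {0..1}" "s' \<in> {0..1}" "t \<in> {0..1}" "t' \<in> {0..1}"
      "\<bar>s - s'\<bar> < \<delta> / 2" "\<bar>t - t'\<bar> < \<delta> / 2"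
    have "dist (s, t) (s', t') \<le> \<bar>s - s'\<bar> + \<bar>t - t'\<bar>"
      using sqrt_sum_squares_le_sum_abs[of "s - s'" "t - t'"] by (simp add: dist_Pair_Pair dist_real_def)
    then show "\<bar>T s t - T s' t'\<bar> < \<epsilon>"
      using \<delta>(2)[rule_format, of "(s', t')" "(s, t)"] * by (simp add: dist_real_def)
  qed
qed

lemma C01_T:
  assumes "c \<in> {0..1}" "f \<in> C01"
  shows "(\<lambda>x. T c (f x)) \<in> C01"
proof -
  have "continuous_on UNIV (\<lambda>x. (c, f x))"
    by (intro continuous_on_Pair continuous_on_const C01_continuous assms(2))
  then have "continuous_on UNIV (\<lambda>x. T (fst (c, f x)) (snd (c, f x)))"
    using assms C01_range[OF assms(2)] by (intro continuous_on_compose2[OF T_continuous]) auto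
  then have "continuous_on UNIV (\<lambda>x. T c (f x))" by simp
  moreover have "T c (f x) \<in> {0..1}" for x
    using C01_range[OF assms(2), of x] by (intro T_range assms(1)) simp
  ultimately show ?thesis by (simp add: C01_def)
qed

end

section \<open>The t-normed integral\<close>

lemma capacity_range:
  assumes "\<nu> \<in> capacities" "closed F"
  shows "\<nu> F \<in> {0..1}"
proof -
  have "\<nu> \<in> {F. closed F} \<rightarrow>\<^sub>E {0..1}" using assms(1) unfolding capacities_def mem_Collect_eq by (elim conjE)
  then show ?thesis by (rule PiE_mem) (simp add: assms(2))
qed

lemma capacity_undefined:
  assumes "\<nu> \<in> capacities" "\<not> closed F"
  shows "\<nu> F = undefined"
proof -
  have "\<nu> \<in> {F. closed F} \<rightarrow>\<^sub>E {0..1}"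
    using assms(1) unfolding capacities_def mem_Collect_eq by (elim conjE)
  then show ?thesis by (rule PiE_arb) (simp add: assms(2))
qed

lemma capacity_mono:
  assumes "\<nu> \<in> capacities" "closed F" "closed G" "F \<subseteq> G"
  shows "\<nu> F \<le> \<nu> G"
proof -
  have "\<forall>F G. closed F \<and> closed G \<and> F \<subseteq> G \<longrightarrow> \<nu> F \<le> \<nu> G"
    using assms(1) unfolding capacities_def mem_Collect_eq by (elim conjE)
  with assms show ?thesis by simp
qed

lemma capacity_outer:
  assumes "\<nu> \<in> capacities" "closed F" "a \<in> {0..1}" "\<nu> F < a"
  obtains U where "open U" "F \<subseteq> U" "\<And>B. compact B \<Longrightarrow> B \<subseteq> U \<Longrightarrow> \<nu> B < a"
proof -
  have "\<forall>F a. closed F \<and> a \<in> {0..1} \<and> \<nu> F < a \<longrightarrow>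
      (\<exists>U. open U \<and> F \<subseteq> U \<and> (\<forall>B. compact B \<and> B \<subseteq> U \<longrightarrow> \<nu> B < a))"
    using assms(1) unfolding capacities_def mem_Collect_eq by (elim conjE)
  from this[rule_format, of F a] obtain U where
    "open U" "F \<subseteq> U" "\<forall>B. compact B \<and> B \<subseteq> U \<longrightarrow> \<nu> B < a"
    using assms(2-4) by auto
  then show thesis by (intro that) auto
qed

lemma possibility_Union:
  assumes "\<nu> \<in> possibility_capacities" "\<A> \<noteq> {}" "\<And>A. A \<in> \<A> \<Longrightarrow> closed A" "closed (\<Union>\<A>)"
  shows "\<nu> (\<Union>\<A>) = (SUP A\<in>\<A>. \<nu> A)"
proof -
  have "\<forall>\<A>. \<A> \<noteq> {} \<and> (\<forall>A\<in>\<A>. closed A) \<and> closed (\<Union>\<A>) \<longrightarrow> \<nu> (\<Union>\<A>) = (SUP A\<in>\<A>. \<nu> A)"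
    using assms(1) unfolding possibility_capacities_def by (elim CollectE conjE)
  with assms(2-4) show ?thesis by simp
qed

text \<open>On the complement of an open set containing a level set, \<open>f\<close> stays below \<open>t\<close> and, by
  compactness, below some \<open>u < t\<close>; hence all levels above \<open>u\<close> lie in that open set.\<close>

lemma capacity_level_upper_semicontinuous:
  fixes \<nu> :: "'a::t2_space set \<Rightarrow> real"
  assumes X: "compact (UNIV :: 'a set)" and \<nu>: "\<nu> \<in> capacities" and f: "f \<in> C01"
    and a: "a \<in> {0..1}" "\<nu> (level f t) < a"
  obtains u where "u < t" "\<And>t'. u < t' \<Longrightarrow> \<nu> (level f t') < a"
proof -
  obtain U where U: "open U" "level f t \<subseteq> U" "\<And>B. compact B \<Longrightarrow> B \<subseteq> U \<Longrightarrow> \<nu> B < a"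
    using capacity_outer[OF \<nu> closed_level[OF f] a] by blast
  have "\<exists>u<t. \<forall>x. x \<notin> U \<longrightarrow> f x \<le> u"
  proof (cases "U = UNIV")
    case True
    \<comment> \<open>The complement of \<open>U\<close> is empty, so any number below \<open>t\<close> serves as the bound.\<close>
    then show ?thesis by (auto intro!: exI[of _ "t - 1"])
  next
    case False
    have "compact (- U)" by (rule closed_imp_compact[OF X closed_Compl[OF U(1)]])
    moreover have "- U \<noteq> {}" using False by auto
    moreover have "continuous_on (- U) f"
      by (rule continuous_on_subset[OF C01_continuous[OF f]]) simp
    ultimately have "\<exists>x\<in>- U. \<forall>y\<in>- U. f y \<le> f x" by (rule continuous_attains_sup)
    then obtain x where "x \<in> - U" "\<forall>y\<in>- U. f y \<le> f x" by (elim bexE)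
    moreover have "f x < t"
      using \<open>x \<in> - U\<close> U(2) level_iff[OF f, of x t] by auto
    ultimately show ?thesis by auto
  qed
  then obtain u where u: "u < t" "\<And>x. x \<notin> U \<Longrightarrow> f x \<le> u" by blast
  have "\<nu> (level f t') < a" if "u < t'" for t'
  proof (rule U(3))
    show "compact (level f t')" by (rule closed_imp_compact[OF X closed_level[OF f]])
    show "level f t' \<subseteq> U"
      using u(2) that level_iff[OF f] by fastforce
  qed
  with u(1) that show thesis by blast
qed

context continuous_t_norm
begin

text \<open>The function \<open>t \<mapsto> \<nu> (level f t)\<close> is only upper semicontinuous, so the extreme value theorem
  does not apply to the terms of the integral. Its truncated hypograph \<open>K\<close> is compact, though, and
  the continuous function \<open>T\<close> attains a maximum there; by monotonicity the maximum over \<open>K\<close> is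
  the maximum over the graph.\<close>

lemma integral_attained:
  fixes \<nu> :: "'a::t2_space set \<Rightarrow> real"
  assumes X: "compact (UNIV :: 'a set)" and \<nu>: "\<nu> \<in> capacities" and f: "f \<in> C01"
  shows "\<exists>t\<in>{0..1}. tnormed_integral T \<nu> f = T (\<nu> (level f t)) t
    \<and> (\<forall>t'\<in>{0..1}. T (\<nu> (level f t')) t' \<le> T (\<nu> (level f t)) t)"
proof -
  define K where "K = {(s, t). s \<in> {0..1} \<and> t \<in> {0..1} \<and> s \<le> \<nu> (level f t)}"
  have range: "\<nu> (level f t) \<in> {0..1}" for t
    by (rule capacity_range[OF \<nu> closed_level[OF f]])
  have K_sub: "K \<subseteq> {0..1} \<times> {0..1}" by (auto simp: K_def)
  have "closed K"
    unfolding closed_sequential_limits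
  proof (intro allI impI, elim conjE)
    fix p :: "nat \<Rightarrow> real \<times> real" and l
    assume p: "\<forall>n. p n \<in> K" and lim: "p \<longlonglongrightarrow> l"
    obtain s t where l: "l = (s, t)" by fastforce
    have "l \<in> {0..1} \<times> {0..1}"
      by (rule closed_sequentially[OF _ _ lim]) (use p K_sub in \<open>auto intro: closed_Times\<close>)
    then have st: "s \<in> {0..1}" "t \<in> {0..1}" by (auto simp: l)
    have lim': "(\<lambda>n. fst (p n)) \<longlonglongrightarrow> s" "(\<lambda>n. snd (p n)) \<longlonglongrightarrow> t"
      using tendsto_fst[OF lim] tendsto_snd[OF lim] by (auto simp: l)
    have "s \<le> \<nu> (level f t)"
    proof (rule ccontr)
      assume "\<not> s \<le> \<nu> (level f t)"
      then obtain a where a: "\<nu> (level f t) < a" "a < s" using dense by (meson not_le)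
      with range[of t] st have "a \<in> {0..1}" by auto
      then obtain u where u: "u < t" "\<And>t'. u < t' \<Longrightarrow> \<nu> (level f t') < a"
        using capacity_level_upper_semicontinuous[OF X \<nu> f _ a(1)] by blast
      have "\<forall>\<^sub>F n in sequentially. a < fst (p n) \<and> u < snd (p n)"
        using order_tendstoD(1)[OF lim'(1) a(2)] order_tendstoD(1)[OF lim'(2) u(1)]
        by eventually_elim auto
      then obtain n where "a < fst (p n)" "u < snd (p n)"
        by (auto simp: eventually_sequentially)
      moreover have "fst (p n) \<le> \<nu> (level f (snd (p n)))"
        using p[rule_format, of n] by (auto simp: K_def)
      ultimately show False using u(2)[of "snd (p n)"] by auto
    qed
    with st show "l \<in> K" by (auto simp: K_def l)
  qed
  then have "compact K"
    using compact_Int_closed[of "{0..1} \<times> {0..1}" K] K_sub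
    by (auto simp: compact_Times Int_absorb1)
  moreover have "(0, 0) \<in> K" using range[of 0] by (auto simp: K_def)
  ultimately obtain q where q: "q \<in> K" "\<forall>p\<in>K. T (fst p) (snd p) \<le> T (fst q) (snd q)"
    using continuous_attains_sup[of K "\<lambda>p. T (fst p) (snd p)"]
      continuous_on_subset[OF T_continuous K_sub] by blast
  obtain s t where st: "q = (s, t)" by fastforce
  have t: "s \<in> {0..1}" "t \<in> {0..1}" "s \<le> \<nu> (level f t)" using q(1) by (auto simp: K_def st)
  have max: "T (\<nu> (level f t')) t' \<le> T (\<nu> (level f t)) t" if "t' \<in> {0..1}" for t'
  proof -
    have "T (\<nu> (level f t')) t' \<le> T s t"
      using q(2)[rule_format, of "(\<nu> (level f t'), t')"] range[of t'] that by (auto simp: K_def st)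
    also have "\<dots> \<le> T (\<nu> (level f t)) t" using t range[of t] by (intro T_mono) auto
    finally show ?thesis .
  qed
  have "tnormed_integral T \<nu> f = T (\<nu> (level f t)) t"
    unfolding tnormed_integral_def by (rule Greatest_equality) (use t max in auto)
  with max t show ?thesis by blast
qed

lemma integral_upper:
  fixes \<nu> :: "'a::t2_space set \<Rightarrow> real"
  assumes "compact (UNIV :: 'a set)" "\<nu> \<in> capacities" "f \<in> C01" "t \<in> {0..1}"
  shows "T (\<nu> (level f t)) t \<le> tnormed_integral T \<nu> f"
  using integral_attained[OF assms(1-3)] assms(4) by auto

lemma integral_range:
  fixes \<nu> :: "'a::t2_space set \<Rightarrow> real"
  assumes "compact (UNIV :: 'a set)" "\<nu> \<in> capacities" "f \<in> C01"
  shows "tnormed_integral T \<nu> f \<in> {0..1}"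
proof -
  obtain t where "t \<in> {0..1}" "tnormed_integral T \<nu> f = T (\<nu> (level f t)) t"
    using integral_attained[OF assms] by blast
  then show ?thesis
    using T_range[OF capacity_range[OF assms(2) closed_level[OF assms(3)]]] by simp
qed

text \<open>Each of the three integrals is one of its own terms, and for a fixed \<open>t\<close> the terms satisfy the
  claimed equation because \<open>\<nu>\<close> turns the union of two level sets into a maximum.\<close>

lemma integral_max:
  fixes \<nu> :: "'a::t2_space set \<Rightarrow> real"
  assumes X: "compact (UNIV :: 'a set)" and \<nu>: "\<nu> \<in> possibility_capacities"
    and f: "f \<in> C01" and g: "g \<in> C01"
  shows "tnormed_integral T \<nu> (\<lambda>x. max (f x) (g x))
    = max (tnormed_integral T \<nu> f) (tnormed_integral T \<nu> g)"
proof -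
  let ?h = "\<lambda>x. max (f x) (g x)"
  have c: "\<nu> \<in> capacities" using \<nu> by (simp add: possibility_capacities_def)
  note h = C01_max[OF f g]
  have union: "\<nu> (A \<union> B) = max (\<nu> A) (\<nu> B)" if "closed A" "closed B" for A B
  proof -
    have "\<nu> (\<Union>{A, B}) = (SUP C\<in>{A, B}. \<nu> C)"
      by (rule possibility_Union[OF \<nu>]) (use that in auto)
    then show ?thesis by (simp add: cSup_insert sup_max)
  qed
  have split: "T (\<nu> (level ?h t)) t = max (T (\<nu> (level f t)) t) (T (\<nu> (level g t)) t)"
    if "t \<in> {0..1}" for t
    unfolding level_max[OF f g] union[OF closed_level[OF f] closed_level[OF g]]
    using that by (intro T_max_left capacity_range[OF c] closed_level f g)
  obtain th where th: "th \<in> {0..1}" "tnormed_integral T \<nu> ?h = T (\<nu> (level ?h th)) th"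
    using integral_attained[OF X c h] by blast
  obtain tf where tf: "tf \<in> {0..1}" "tnormed_integral T \<nu> f = T (\<nu> (level f tf)) tf"
    using integral_attained[OF X c f] by blast
  obtain tg where tg: "tg \<in> {0..1}" "tnormed_integral T \<nu> g = T (\<nu> (level g tg)) tg"
    using integral_attained[OF X c g] by blast
  show ?thesis
  proof (rule antisym)
    show "tnormed_integral T \<nu> ?h \<le> max (tnormed_integral T \<nu> f) (tnormed_integral T \<nu> g)"
      unfolding th(2) split[OF th(1)]
      by (intro max.mono integral_upper X c f g th(1))
    have "tnormed_integral T \<nu> f \<le> T (\<nu> (level ?h tf)) tf"
      unfolding tf(2) split[OF tf(1)] by simp
    moreover have "tnormed_integral T \<nu> g \<le> T (\<nu> (level ?h tg)) tg"
      unfolding tg(2) split[OF tg(1)] by simp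
    ultimately show "max (tnormed_integral T \<nu> f) (tnormed_integral T \<nu> g) \<le> tnormed_integral T \<nu> ?h"
      using integral_upper[OF X c h tf(1)] integral_upper[OF X c h tg(1)]
      by (meson max.boundedI order_trans)
  qed
qed

end

section \<open>The capacity induced by a functional\<close>

text \<open>Restricting to closed sets makes the result extensional, as capacities are.\<close>

definition outer_capacity :: "(('a::topological_space \<Rightarrow> real) \<Rightarrow> real) \<Rightarrow> 'a set \<Rightarrow> real" where
  "outer_capacity \<mu> = (\<lambda>F\<in>{F. closed F}. INF f\<in>{f\<in>C01. \<forall>x\<in>F. f x = 1}. \<mu> f)"

lemma outer_capacity_le:
  assumes "\<forall>f\<in>C01. 0 \<le> \<mu> f" "closed F" "f \<in> C01" "\<And>x. x \<in> F \<Longrightarrow> f x = 1"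
  shows "outer_capacity \<mu> F \<le> \<mu> f"
proof -
  have "bdd_below (\<mu> ` {f\<in>C01. \<forall>x\<in>F. f x = 1})"
    by (rule bdd_belowI[of _ 0]) (use assms(1) in auto)
  then show ?thesis
    using assms unfolding outer_capacity_def by (auto intro!: cINF_lower)
qed

lemma outer_capacity_greatest:
  assumes "closed F" "\<And>f. f \<in> C01 \<Longrightarrow> (\<And>x. x \<in> F \<Longrightarrow> f x = 1) \<Longrightarrow> m \<le> \<mu> f"
  shows "m \<le> outer_capacity \<mu> F"
proof -
  have "(\<lambda>x. 1) \<in> {f\<in>C01. \<forall>x\<in>F. f x = 1}" by (auto intro: C01_const)
  then show ?thesis
    using assms unfolding outer_capacity_def by (auto intro!: cINF_greatest)
qed

lemma outer_capacity_less:
  assumes "closed F" "outer_capacity \<mu> F < a"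
  obtains f where "f \<in> C01" "\<And>x. x \<in> F \<Longrightarrow> f x = 1" "\<mu> f < a"
  using outer_capacity_greatest[OF assms(1), of a \<mu>] assms(2) by force

text \<open>If \<open>f = 1\<close> on \<open>F\<close>, the term at \<open>t = 1\<close> already gives \<open>\<nu> F \<le> \<mu> f\<close>. If \<open>\<nu> F\<close> were
  strictly below the outer capacity, a Urysohn function supported in a neighbourhood on which \<open>\<nu>\<close>
  is still below it would have an integral that is too small: its level sets at \<open>t > 0\<close> lie in
  that neighbourhood.\<close>

lemma (in continuous_t_norm) capacity_eq_outer_capacity:
  fixes \<nu> :: "'a::t2_space set \<Rightarrow> real"
  assumes X: "compact (UNIV :: 'a set)" and \<nu>: "\<nu> \<in> capacities"
    and rep: "\<And>f. f \<in> C01 \<Longrightarrow> \<mu> f = tnormed_integral T \<nu> f"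
  shows "\<nu> = outer_capacity \<mu>"
proof
  fix F :: "'a set"
  have lower: "\<nu> F \<le> \<mu> f" if F: "closed F" and f: "f \<in> C01" "\<And>x. x \<in> F \<Longrightarrow> f x = 1" for f F
  proof -
    have "\<nu> F \<le> \<nu> (level f 1)"
      using f by (intro capacity_mono[OF \<nu> F closed_level]) auto
    also have "\<dots> = T (\<nu> (level f 1)) 1"
      by (rule T_1[OF capacity_range[OF \<nu> closed_level[OF f(1)]], symmetric])
    also have "\<dots> \<le> \<mu> f" unfolding rep[OF f(1)] by (rule integral_upper[OF X \<nu> f(1)]) simp
    finally show ?thesis .
  qed
  have nonneg: "\<forall>f\<in>C01. 0 \<le> \<mu> f"
    using integral_range[OF X \<nu>] rep by simp
  show "\<nu> F = outer_capacity \<mu> F"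
  proof (cases "closed F")
    case False
    then show ?thesis
      using capacity_undefined[OF \<nu> False] by (simp add: outer_capacity_def)
  next
    case F: True
    have "outer_capacity \<mu> F \<le> \<nu> F"
    proof (rule ccontr)
      assume "\<not> outer_capacity \<mu> F \<le> \<nu> F"
      then have less: "\<nu> F < outer_capacity \<mu> F" by simp
      have "outer_capacity \<mu> F \<le> \<mu> (\<lambda>x. 1)"
        by (rule outer_capacity_le[OF nonneg F]) (auto intro: C01_const)
      also have "\<dots> \<le> 1"
        using integral_range[OF X \<nu> C01_const[of 1]] rep[OF C01_const[of 1]] by simp
      finally have a: "outer_capacity \<mu> F \<in> {0..1}"
        using less capacity_range[OF \<nu> F] by auto
      obtain U where U: "open U" "F \<subseteq> U" "\<And>B. compact B \<Longrightarrow> B \<subseteq> U \<Longrightarrow> \<nu> B < outer_capacity \<mu> F"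
        using capacity_outer[OF \<nu> F a less] by blast
      obtain f where f: "f \<in> C01" "\<And>x. x \<in> F \<Longrightarrow> f x = 1" "\<And>x. x \<notin> U \<Longrightarrow> f x = 0"
        using Urysohn_C01[OF X F U(1,2)] by blast
      obtain t where t: "t \<in> {0..1}" "\<mu> f = T (\<nu> (level f t)) t"
        using integral_attained[OF X \<nu> f(1)] rep[OF f(1)] by auto
      note range = capacity_range[OF \<nu> closed_level[OF f(1)]]
      have "\<mu> f < outer_capacity \<mu> F"
      proof (cases "t = 0")
        case True
        then show ?thesis using t T_0[OF range] less capacity_range[OF \<nu> F] by auto
      next
        case False
        then have "level f t \<subseteq> U" using f(3) t(1) by fastforce
        moreover have "compact (level f t)"
          by (rule closed_imp_compact[OF X closed_level[OF f(1)]])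
        ultimately have "\<nu> (level f t) < outer_capacity \<mu> F" by (rule U(3)[rotated])
        then show ?thesis unfolding t(2) using T_le_left[OF range t(1), of t] by (rule le_less_trans[rotated])
      qed
      then show False using outer_capacity_le[OF nonneg F f(1,2)] by simp
    qed
    then show ?thesis using outer_capacity_greatest[OF F, of "\<nu> F" \<mu>] lower[OF F] by force
  qed
qed

section \<open>Representation of star-measures\<close>

locale star_measure = continuous_t_norm T for T +
  fixes \<mu> :: "('a::t2_space \<Rightarrow> real) \<Rightarrow> real"
  assumes compact_space: "compact (UNIV :: 'a set)"
    and star_measure: "\<mu> \<in> star_measures T"
begin

lemma functional: "\<mu> \<in> T_functionals T"
  using star_measure unfolding star_measures_def by (elim CollectE conjE)

lemma range:
  assumes "f \<in> C01"
  shows "\<mu> f \<in> {0..1}"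
proof -
  have "\<mu> \<in> C01 \<rightarrow>\<^sub>E {0..1}"
    using functional unfolding T_functionals_def by (elim CollectE conjE)
  then show ?thesis by (rule PiE_mem) (rule assms)
qed

lemma one: "\<mu> (\<lambda>x. 1) = 1"
  using functional unfolding T_functionals_def by (elim CollectE conjE)

lemma max:
  assumes "f \<in> C01" "g \<in> C01"
  shows "\<mu> (\<lambda>x. max (f x) (g x)) = max (\<mu> f) (\<mu> g)"
proof -
  have "\<forall>\<phi>\<in>C01. \<forall>\<psi>\<in>C01. \<mu> (\<lambda>x. max (\<psi> x) (\<phi> x)) = max (\<mu> \<psi>) (\<mu> \<phi>)"
    using star_measure unfolding star_measures_def by (elim CollectE conjE)
  with assms show ?thesis by simp
qed

lemma homogeneous:
  assumes "c \<in> {0..1}" "f \<in> C01"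
  shows "\<mu> (\<lambda>x. T c (f x)) = T c (\<mu> f)"
proof -
  have "\<forall>c\<in>{0..1}. \<forall>\<phi>\<in>C01. \<mu> (\<lambda>x. T c (\<phi> x)) = T c (\<mu> \<phi>)"
    using functional unfolding T_functionals_def by (elim CollectE conjE)
  with assms show ?thesis by blast
qed

lemma mono:
  assumes "f \<in> C01" "g \<in> C01" "\<And>x. f x \<le> g x"
  shows "\<mu> f \<le> \<mu> g"
proof -
  have "(\<lambda>x. max (f x) (g x)) = g" using assms(3) by (auto simp: max_def)
  then show ?thesis using max[OF assms(1,2)] by simp
qed

lemma zero: "\<mu> (\<lambda>x. 0) = 0"
  using homogeneous[of 0 "\<lambda>x. 1"] C01_const[of 1] one T_1[of 0] by simp

lemma nonneg: "\<forall>f\<in>C01. 0 \<le> \<mu> f"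
  using range by auto

text \<open>A maximum of finitely many functions, stated through a bound \<open>m\<close> so that the empty family is
  covered by the zero function.\<close>

lemma common_upper_bound:
  assumes "finite I" "\<And>i. i \<in> I \<Longrightarrow> g i \<in> C01 \<and> \<mu> (g i) \<le> m" "0 \<le> m"
  shows "\<exists>G\<in>C01. (\<forall>i\<in>I. \<forall>x. g i x \<le> G x) \<and> \<mu> G \<le> m"
  using assms(1,2)
proof (induction I rule: finite_induct)
  case empty
  then show ?case using zero assms(3) C01_const[of 0] by (auto intro!: bexI[of _ "\<lambda>x. 0"])
next
  case (insert i I)
  then obtain G where G: "G \<in> C01" "\<forall>i\<in>I. \<forall>x. g i x \<le> G x" "\<mu> G \<le> m" by auto
  have gi: "g i \<in> C01" "\<mu> (g i) \<le> m" using insert.prems by auto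
  show ?case
    by (rule bexI[of _ "\<lambda>x. max (g i x) (G x)", OF _ C01_max[OF gi(1) G(1)]])
      (use G gi max[OF gi(1) G(1)] in \<open>auto simp: le_max_iff_disj\<close>)
qed

text \<open>Where \<open>f > c\<close>, the value \<open>T c (ramp c d f x)\<close> is at most \<open>c\<close>, hence below \<open>f x\<close>; elsewhere it
  is \<open>0\<close>. For the product t-norm this is Markov's inequality with a continuous function in place of
  the indicator of a level set.\<close>

lemma Markov:
  assumes f: "f \<in> C01" and c: "0 \<le> c" "c < d" "d \<le> 1"
  shows "T c (\<mu> (ramp c d f)) \<le> \<mu> f"
proof -
  note r = C01_ramp[OF f c(2)]
  have c01: "c \<in> {0..1}" using c by auto
  have "T c (ramp c d f x) \<le> f x" for x
  proof (cases "f x \<le> c")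
    case True
    then show ?thesis using T_0[OF c01] C01_range[OF f, of x] c by (simp add: ramp_eq_0)
  next
    case False
    then show ?thesis using T_le_left[OF c01, of "ramp c d f x"] C01_range[OF r, of x] by auto
  qed
  then have "\<mu> (\<lambda>x. T c (ramp c d f x)) \<le> \<mu> f" by (intro mono C01_T c01 r f)
  then show ?thesis using homogeneous[OF c01 r] by simp
qed

text \<open>A ramp of \<open>f\<close> between two values slightly below \<open>1\<close> does it: \<open>T c\<close> is nearly the identity for
  \<open>c\<close> near \<open>1\<close>, so by Markov's inequality the ramp has nearly as small a value as \<open>f\<close>.\<close>

lemma thicken:
  assumes f: "f \<in> C01" and a: "\<mu> f < a"
  obtains g U where "g \<in> C01" "\<mu> g < a" "open U" "\<And>x. x \<in> U \<Longrightarrow> g x = 1" "\<And>x. f x = 1 \<Longrightarrow> x \<in> U"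
proof -
  obtain \<delta> where \<delta>: "0 < \<delta>"
    "\<And>s s' t t'. s \<in> {0..1} \<Longrightarrow> s' \<in> {0..1} \<Longrightarrow> t \<in> {0..1} \<Longrightarrow> t' \<in> {0..1} \<Longrightarrow>
      \<bar>s - s'\<bar> < \<delta> \<Longrightarrow> \<bar>t - t'\<bar> < \<delta> \<Longrightarrow> \<bar>T s t - T s' t'\<bar> < a - \<mu> f"
    using T_uniformly_continuous[of "a - \<mu> f"] a by auto
  define c where "c = 1 - min 1 (\<delta> / 2)"
  define d where "d = (1 + c) / 2"
  have c: "0 \<le> c" "c < d" "d < 1" "\<bar>1 - c\<bar> < \<delta>" using \<delta>(1) by (auto simp: c_def d_def)
  let ?g = "ramp c d f"
  note g = C01_ramp[OF f c(2)]
  have "\<bar>T 1 (\<mu> ?g) - T c (\<mu> ?g)\<bar> < a - \<mu> f"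
    by (rule \<delta>(2)) (use c \<delta>(1) range[OF g] in auto)
  moreover have "T c (\<mu> ?g) \<le> \<mu> f" using Markov[OF f, of c d] c by simp
  ultimately have "\<mu> ?g < a" using T_1_left[OF range[OF g]] by linarith
  moreover have "open {x. d < f x}"
    using C01_continuous[OF f] by (intro open_Collect_less continuous_intros)
  ultimately show thesis
    using that[of ?g "{x. d < f x}"] g c ramp_eq_1[of c d f] by auto
qed

lemma outer_capacity_thicken:
  assumes "closed F" "outer_capacity \<mu> F < a"
  obtains g U where "g \<in> C01" "\<mu> g < a" "open U" "F \<subseteq> U" "\<And>x. x \<in> U \<Longrightarrow> g x = 1"
proof -
  obtain f where "f \<in> C01" "\<And>x. x \<in> F \<Longrightarrow> f x = 1" "\<mu> f < a"
    using outer_capacity_less[OF assms] by blast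
  then show thesis
    using thicken[of f a] that by (metis subsetI)
qed

lemma outer_capacity_mono:
  assumes "closed F" "closed G" "F \<subseteq> G"
  shows "outer_capacity \<mu> F \<le> outer_capacity \<mu> G"
  using assms by (auto intro!: outer_capacity_greatest outer_capacity_le nonneg)

lemma outer_capacity_range: "closed F \<Longrightarrow> outer_capacity \<mu> F \<in> {0..1}"
  using outer_capacity_le[OF nonneg, where F = F and f = "\<lambda>x. 1"] one C01_const[of 1]
    outer_capacity_greatest[of F 0 \<mu>] nonneg by auto

lemma outer_capacity_capacity: "outer_capacity \<mu> \<in> capacities"
proof -
  have "outer_capacity \<mu> \<in> {F. closed F} \<rightarrow>\<^sub>E {0..1}"
    using outer_capacity_range by (auto simp: outer_capacity_def)
  moreover have "outer_capacity \<mu> UNIV = 1"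
  proof -
    have "1 \<le> outer_capacity \<mu> UNIV"
    proof (rule outer_capacity_greatest)
      fix f :: "'a \<Rightarrow> real"
      assume "\<And>x. x \<in> UNIV \<Longrightarrow> f x = 1"
      then have "f = (\<lambda>x. 1)" by auto
      then show "1 \<le> \<mu> f" using one by simp
    qed simp
    then show ?thesis using outer_capacity_range[of UNIV] by auto
  qed
  moreover have "outer_capacity \<mu> {} = 0"
    using outer_capacity_le[OF nonneg, where F = "{}" and f = "\<lambda>x. 0"] zero C01_const[of 0]
      outer_capacity_range[of "{}"] by auto
  moreover have "\<forall>F a. closed F \<and> a \<in> {0..1} \<and> outer_capacity \<mu> F < a \<longrightarrow>
      (\<exists>U. open U \<and> F \<subseteq> U \<and> (\<forall>B. compact B \<and> B \<subseteq> U \<longrightarrow> outer_capacity \<mu> B < a))"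
  proof (intro allI impI, elim conjE)
    fix F and a :: real
    assume F: "closed F" "outer_capacity \<mu> F < a"
    obtain g U where g: "g \<in> C01" "\<mu> g < a" "open U" "F \<subseteq> U" "\<And>x. x \<in> U \<Longrightarrow> g x = 1"
      using outer_capacity_thicken[OF F] by blast
    have "outer_capacity \<mu> B < a" if "compact B" "B \<subseteq> U" for B
    proof -
      have "outer_capacity \<mu> B \<le> \<mu> g"
        using that g by (intro outer_capacity_le nonneg) (auto intro: compact_imp_closed)
      then show ?thesis using g(2) by simp
    qed
    with g show "\<exists>U. open U \<and> F \<subseteq> U \<and> (\<forall>B. compact B \<and> B \<subseteq> U \<longrightarrow> outer_capacity \<mu> B < a)"
      by blast
  qed
  moreover have "\<forall>F G. closed F \<and> closed G \<and> F \<subseteq> G \<longrightarrow> outer_capacity \<mu> F \<le> outer_capacity \<mu> G"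
    using outer_capacity_mono by simp
  ultimately show ?thesis
    unfolding capacities_def mem_Collect_eq by (intro conjI)
qed

text \<open>If \<open>a\<close> exceeds the supremum, every member \<open>A\<close> of the family has a neighbourhood carrying a
  function of value less than \<open>a\<close> that is \<open>1\<close> there. Finitely many of these neighbourhoods cover
  the compact union, and the maximum of the corresponding functions bounds the outer capacity of the
  union by \<open>a\<close>. The maximum runs over functions that need not be comonotone.\<close>

lemma outer_capacity_possibility: "outer_capacity \<mu> \<in> possibility_capacities"
proof -
  have "outer_capacity \<mu> (\<Union>\<A>) = (SUP A\<in>\<A>. outer_capacity \<mu> A)"
    if ne: "\<A> \<noteq> {}" and cl: "\<And>A. A \<in> \<A> \<Longrightarrow> closed A" and clU: "closed (\<Union>\<A>)" for \<A>
  proof (rule antisym)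
    let ?s = "SUP A\<in>\<A>. outer_capacity \<mu> A"
    have bdd: "bdd_above (outer_capacity \<mu> ` \<A>)"
      by (rule bdd_aboveI[of _ 1]) (use cl outer_capacity_range in auto)
    show "?s \<le> outer_capacity \<mu> (\<Union>\<A>)"
      using ne cl clU by (intro cSUP_least outer_capacity_mono) auto
    show "outer_capacity \<mu> (\<Union>\<A>) \<le> ?s"
    proof (rule dense_ge)
      fix a assume a: "?s < a"
      have "\<exists>g U. g \<in> C01 \<and> \<mu> g < a \<and> open U \<and> A \<subseteq> U \<and> (\<forall>x\<in>U. g x = 1)" if "A \<in> \<A>" for A
      proof -
        have "outer_capacity \<mu> A < a" using cSUP_upper[OF that bdd] a by simp
        then show ?thesis using outer_capacity_thicken[OF cl[OF that]] by metis
      qed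
      then obtain g U where g: "\<And>A. A \<in> \<A> \<Longrightarrow> g A \<in> C01 \<and> \<mu> (g A) < a \<and> open (U A) \<and> A \<subseteq> U A
          \<and> (\<forall>x\<in>U A. g A x = 1)" by metis
      have "compact (\<Union>\<A>)" by (rule closed_imp_compact[OF compact_space clU])
      then obtain \<B> where \<B>: "\<B> \<subseteq> \<A>" "finite \<B>" "\<Union>\<A> \<subseteq> (\<Union>A\<in>\<B>. U A)"
        using g by (elim compactE_image[of "\<Union>\<A>" \<A> U]) blast+
      obtain A where "A \<in> \<A>" using ne by blast
      then have "0 \<le> a" using g nonneg by (meson less_imp_le order_trans)
      then obtain G where G: "G \<in> C01" "\<And>A x. A \<in> \<B> \<Longrightarrow> g A x \<le> G x" "\<mu> G \<le> a"
        using common_upper_bound[OF \<B>(2), of g a] g \<B>(1) by (meson less_imp_le subsetD)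
      have "G x = 1" if x: "x \<in> \<Union>\<A>" for x
      proof -
        obtain A where "A \<in> \<B>" "x \<in> U A" using \<B>(3) x by blast
        then have "1 \<le> G x" using G(2)[of A x] g[of A] \<B>(1) by auto
        then show ?thesis using C01_range[OF G(1), of x] by simp
      qed
      then show "outer_capacity \<mu> (\<Union>\<A>) \<le> a"
        using outer_capacity_le[OF nonneg clU G(1)] G(3) by force
    qed
  qed
  then have "\<forall>\<A>. \<A> \<noteq> {} \<and> (\<forall>A\<in>\<A>. closed A) \<and> closed (\<Union>\<A>) \<longrightarrow>
      outer_capacity \<mu> (\<Union>\<A>) = (SUP A\<in>\<A>. outer_capacity \<mu> A)"
    by simp
  with outer_capacity_capacity show ?thesis
    unfolding possibility_capacities_def mem_Collect_eq by (intro conjI)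
qed

text \<open>The ramp between \<open>c < t\<close> and \<open>t\<close> is \<open>1\<close> on the level set, so Markov's inequality bounds
  \<open>T c (outer_capacity \<mu> (level f t))\<close>; then \<open>c\<close> tends to \<open>t\<close>. A ramp needs \<open>c\<close> strictly below
  \<open>t\<close>, which is why \<open>t = 0\<close> is separate.\<close>

lemma level_term_le:
  assumes f: "f \<in> C01" and t: "t \<in> {0..1}"
  shows "T (outer_capacity \<mu> (level f t)) t \<le> \<mu> f"
proof (rule field_le_epsilon)
  fix e :: real assume e: "0 < e"
  let ?v = "outer_capacity \<mu> (level f t)"
  note v = outer_capacity_range[OF closed_level[OF f], of t]
  show "T ?v t \<le> \<mu> f + e"
  proof (cases "t = 0")
    case True
    then show ?thesis using T_0[OF v] nonneg[rule_format, OF f] e by simp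
  next
    case False
    obtain \<delta> where \<delta>: "0 < \<delta>"
      "\<And>s s' t t'. s \<in> {0..1} \<Longrightarrow> s' \<in> {0..1} \<Longrightarrow> t \<in> {0..1} \<Longrightarrow> t' \<in> {0..1} \<Longrightarrow>
        \<bar>s - s'\<bar> < \<delta> \<Longrightarrow> \<bar>t - t'\<bar> < \<delta> \<Longrightarrow> \<bar>T s t - T s' t'\<bar> < e"
      using T_uniformly_continuous[OF e] by blast
    define c where "c = t - min t (\<delta> / 2)"
    have c: "0 \<le> c" "c < t" "\<bar>t - c\<bar> < \<delta>" "c \<in> {0..1}"
      using \<delta>(1) t False by (auto simp: c_def min_def)
    let ?g = "ramp c t f"
    note g = C01_ramp[OF f c(2)]
    have "?v \<le> \<mu> ?g"
      using c(2) level_iff[OF f]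
      by (intro outer_capacity_le nonneg closed_level f g) (auto intro: ramp_eq_1)
    then have "T c ?v \<le> T c (\<mu> ?g)" using c(4) v range[OF g] by (intro T_mono) auto
    also have "\<dots> \<le> \<mu> f" using Markov[OF f, of c t] c t by auto
    finally have "T ?v c \<le> \<mu> f" using T_commute[OF v c(4)] by simp
    moreover have "\<bar>T ?v t - T ?v c\<bar> < e" by (rule \<delta>(2)) (use v t c \<delta>(1) in auto)
    ultimately show ?thesis by linarith
  qed
qed

text \<open>Cut \<open>[0,1]\<close> at the points \<open>t i = i / n\<close> and take \<open>g i\<close> equal to \<open>1\<close> on the level set at \<open>t i\<close>
  and nearly optimal for the outer capacity of that set. At a point where \<open>f\<close> lies between \<open>t i\<close> and
  \<open>t (Suc i)\<close>, the function \<open>h i = T (t (Suc i)) (g i)\<close> equals \<open>t (Suc i) \<ge> f\<close>, so \<open>f\<close> is below the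
  maximum of the \<open>h i\<close>. By homogeneity and uniform continuity of \<open>T\<close>, the value of \<open>\<mu>\<close> at \<open>h i\<close>
  exceeds the term of the integral at \<open>t i\<close> by less than \<open>e\<close>.\<close>

lemma le_of_level_terms:
  assumes f: "f \<in> C01" and m: "\<And>t. t \<in> {0..1} \<Longrightarrow> T (outer_capacity \<mu> (level f t)) t \<le> m"
  shows "\<mu> f \<le> m"
proof (rule field_le_epsilon)
  fix e :: real assume e: "0 < e"
  let ?v = "\<lambda>t. outer_capacity \<mu> (level f t)"
  have v: "?v t \<in> {0..1}" for t by (rule outer_capacity_range[OF closed_level[OF f]])
  have m0: "0 \<le> m" using m[of 0] T_range[OF v[of 0], of 0] by auto
  obtain \<delta> where \<delta>: "0 < \<delta>"
    "\<And>s s' t t'. s \<in> {0..1} \<Longrightarrow> s' \<in> {0..1} \<Longrightarrow> t \<in> {0..1} \<Longrightarrow> t' \<in> {0..1} \<Longrightarrow>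
      \<bar>s - s'\<bar> < \<delta> \<Longrightarrow> \<bar>t - t'\<bar> < \<delta> \<Longrightarrow> \<bar>T s t - T s' t'\<bar> < e"
    using T_uniformly_continuous[OF e] by blast
  obtain n :: nat where n: "0 < n" "1 / real n < \<delta>"
    using \<delta>(1) by (metis nat_approx_posE zero_less_Suc)
  define t where "t i = real i / real n" for i
  have t01: "t i \<in> {0..1}" if "i \<le> n" for i using that n(1) by (auto simp: t_def)
  have step: "t (Suc i) = t i + 1 / n" for i by (simp add: t_def add_divide_distrib)
  have "\<exists>g\<in>C01. (\<forall>x\<in>level f (t i). g x = 1) \<and> \<mu> g < ?v (t i) + \<delta>" for i
    using outer_capacity_less[OF closed_level[OF f], of \<mu> "t i" "?v (t i) + \<delta>"] \<delta>(1)
    by (metis less_add_same_cancel1)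
  then obtain g where g: "\<And>i. g i \<in> C01" "\<And>i x. x \<in> level f (t i) \<Longrightarrow> g i x = 1"
      "\<And>i. \<mu> (g i) < ?v (t i) + \<delta>" by metis
  define h where "h i x = T (t (Suc i)) (g i x)" for i x
  have h: "h i \<in> C01 \<and> \<mu> (h i) \<le> m + e" if "i \<in> {..<n}" for i
  proof -
    have i: "t i \<in> {0..1}" "t (Suc i) \<in> {0..1}" using that t01[of i] t01[of "Suc i"] by auto
    have hC: "h i \<in> C01" unfolding h_def by (rule C01_T[OF i(2) g(1)])
    have "?v (t i) \<le> \<mu> (g i)"
      by (rule outer_capacity_le[OF nonneg closed_level[OF f] g(1)]) (use g(2) in auto)
    then have "\<bar>\<mu> (g i) - ?v (t i)\<bar> < \<delta>" using g(3)[of i] by simp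
    moreover have "\<bar>t (Suc i) - t i\<bar> < \<delta>" using step n by simp
    ultimately have "\<bar>T (\<mu> (g i)) (t (Suc i)) - T (?v (t i)) (t i)\<bar> < e"
      by (intro \<delta>(2) range g v i)
    then have "T (\<mu> (g i)) (t (Suc i)) \<le> m + e" using m[OF i(1)] by linarith
    moreover have "\<mu> (h i) = T (\<mu> (g i)) (t (Suc i))"
      unfolding h_def using homogeneous[OF i(2) g(1)] T_commute[OF i(2) range[OF g(1)]] by simp
    ultimately show ?thesis using hC by simp
  qed
  obtain G where G: "G \<in> C01" "\<forall>i\<in>{..<n}. \<forall>x. h i x \<le> G x" "\<mu> G \<le> m + e"
    using common_upper_bound[of "{..<n}" h "m + e"] h m0 e by auto
  have "f x \<le> G x" for x
  proof -
    have fx: "0 \<le> f x" "f x \<le> 1" using C01_range[OF f, of x] by auto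
    have "\<exists>i<n. t i \<le> f x \<and> f x \<le> t (Suc i)"
    proof (cases "f x = 1")
      case True
      \<comment> \<open>The floor below would give \<open>n\<close>, which is not an index; the last interval contains \<open>1\<close>.\<close>
      with n(1) show ?thesis by (intro exI[of _ "n - 1"]) (auto simp: t_def divide_simps)
    next
      case False
      define i where "i = nat \<lfloor>n * f x\<rfloor>"
      have "real i \<le> n * f x" "n * f x < real i + 1" using fx by (auto simp: i_def)
      moreover have "n * f x < n" using fx False n(1) by simp
      ultimately have "real i < real n" "n * f x \<le> real (Suc i)" "real i \<le> n * f x"
        by linarith+
      then have "i < n" "real i / n \<le> f x" "f x \<le> real (Suc i) / n"
        using n(1) by (simp_all add: pos_divide_le_eq pos_le_divide_eq mult.commute)
      then show ?thesis by (auto simp: t_def)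
    qed
    then obtain i where i: "i < n" "t i \<le> f x" "f x \<le> t (Suc i)" by blast
    then have "g i x = 1" using g(2)[of x i] level_iff[OF f, of x "t i"] by blast
    then have "h i x = t (Suc i)" using T_1[OF t01[of "Suc i"]] i(1) by (simp add: h_def)
    then show ?thesis using i G(2)[rule_format, of i x] by simp
  qed
  then have "\<mu> f \<le> \<mu> G" by (intro mono f G(1))
  then show "\<mu> f \<le> m + e" using G(3) by simp
qed

lemma representation:
  assumes f: "f \<in> C01"
  shows "\<mu> f = tnormed_integral T (outer_capacity \<mu>) f"
proof (rule antisym)
  show "\<mu> f \<le> tnormed_integral T (outer_capacity \<mu>) f"
    by (intro le_of_level_terms f integral_upper compact_space outer_capacity_capacity)
  show "tnormed_integral T (outer_capacity \<mu>) f \<le> \<mu> f"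
    using integral_attained[OF compact_space outer_capacity_capacity f] level_term_le[OF f] by auto
qed

end

theorem theorem1:
  fixes T :: "real \<Rightarrow> real \<Rightarrow> real"
    and \<mu> :: "('a::t2_space \<Rightarrow> real) \<Rightarrow> real"
  assumes "compact (UNIV :: 'a set)"
    and "continuous_tnorm T"
    and "\<mu> \<in> T_functionals T"
  shows "\<mu> \<in> star_measures T \<longleftrightarrow>
    (\<exists>!\<nu>. \<nu> \<in> possibility_capacities \<and> (\<forall>f\<in>C01. \<mu> f = tnormed_integral T \<nu> f))"
proof
  interpret continuous_t_norm T by unfold_locales (rule assms(2))
  {
    assume "\<mu> \<in> star_measures T"
    then interpret star_measure T \<mu> by unfold_locales (use assms in auto)
    show "\<exists>!\<nu>. \<nu> \<in> possibility_capacities \<and> (\<forall>f\<in>C01. \<mu> f = tnormed_integral T \<nu> f)"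
    proof (rule ex1I[of _ "outer_capacity \<mu>"])
      show "outer_capacity \<mu> \<in> possibility_capacities \<and>
          (\<forall>f\<in>C01. \<mu> f = tnormed_integral T (outer_capacity \<mu>) f)"
        using outer_capacity_possibility representation by blast
      show "\<nu> = outer_capacity \<mu>"
        if "\<nu> \<in> possibility_capacities \<and> (\<forall>f\<in>C01. \<mu> f = tnormed_integral T \<nu> f)" for \<nu>
        using that by (intro capacity_eq_outer_capacity assms(1))
          (auto simp: possibility_capacities_def)
    qed
  next
    assume "\<exists>!\<nu>. \<nu> \<in> possibility_capacities \<and> (\<forall>f\<in>C01. \<mu> f = tnormed_integral T \<nu> f)"
    then obtain \<nu> where \<nu>: "\<nu> \<in> possibility_capacities" "\<forall>f\<in>C01. \<mu> f = tnormed_integral T \<nu> f"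
      by blast
    have "\<mu> (\<lambda>x. max (\<psi> x) (\<phi> x)) = max (\<mu> \<psi>) (\<mu> \<phi>)" if "\<phi> \<in> C01" "\<psi> \<in> C01" for \<phi> \<psi>
      using integral_max[OF assms(1) \<nu>(1) that(2,1)] \<nu>(2) that C01_max[OF that(2,1)] by simp
    then have "\<forall>\<phi>\<in>C01. \<forall>\<psi>\<in>C01. \<mu> (\<lambda>x. max (\<psi> x) (\<phi> x)) = max (\<mu> \<psi>) (\<mu> \<phi>)"
      by simp
    with assms(3) show "\<mu> \<in> star_measures T"
      unfolding star_measures_def mem_Collect_eq by (intro conjI)
  }
qed

end
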